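(* Consider the set $\mathcal{F}$ of pairs $(P_{\rm s},d)$ satisfying $P_{\rm s}\,\mathbb{E}[|h_{\rm sc}|^2]\le I^{\rm th}$, $0\le P_{\rm s}\le P_{\rm s}^{\max}$ and $\sqrt{\delta^2-y^2}\le d\le d_{\rm sd}-\sqrt{\delta^2-y^2}$. Minimizing the outage probability $p_{\rm out}(P_{\rm s},d)=\mathbb{P}[\Gamma_{\rm d}\le\gamma_{\rm th}]$ of the D2D pair over $\mathcal{F}$ is equivalent to maximizing the expected value $\mathbb{E}[\Gamma_{\rm d}]$ over $\mathcal{F}$; that is, a pair $(P_{\rm s},d)\in\mathcal{F}$ minimizes $p_{\rm out}$ over $\mathcal{F}$ if and only if it maximizes $\mathbb{E}[\Gamma_{\rm d}]$ over $\mathcal{F}$.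
   Context: Constants: integers $N,M\ge1$; positive reals $d_0,d_{\rm sd},d_{\rm bd},\eta,\delta,N_0,P_{\rm b},P_{\rm s}^{\max},I^{\rm th},\gamma_{\rm th}$; $\alpha\in(0,1]$; $0\le y\le\delta$; and $\mathbb{E}[|h_{\rm sc}|^2]>0$ is a fixed constant. The RIS (reconfigurable intelligent surface) is placed on a line parallel to the source–destination segment ("parallel topology"), with source–RIS distance $\sqrt{d^2+y^2}$ and RIS–destination distance $\sqrt{(d_{\rm sd}-d)^2+y^2}$. The path losses are $$\beta_{\rm sr}=\left(\frac{d_0}{\sqrt{d^2+y^2}}\right)^\eta,\quad \beta_{\rm rd}=\left(\frac{d_0}{\sqrt{(d_{\rm sd}-d)^2+y^2}}\right)^\eta,\quad \beta_{\rm sd}=\left(\frac{d_0}{d_{\rm sd}}\right)^\eta,\quad \beta_{\rm bd}=\left(\frac{d_0}{d_{\rm bd}}\right)^\eta .$$ The channel coefficients $h_{\rm sd}$, $h_{{\rm sr},n}$, $h_{{\rm rd},n}$ ($1\le n\le N$) and $h_{{\rm bd},m}$ ($1\le m\le M$) are mutually independent, with $h_{\rm sd}=\sqrt{\beta_{\rm sd}}\,\tilde h_{\rm sd}$, $h_{{\rm sr},n}=\sqrt{\beta_{\rm sr}}\,\tilde h_{{\rm sr},n}$, $h_{{\rm rd},n}=\sqrt{\beta_{\rm rd}}\,\tilde h_{{\rm rd},n}$ and $h_{{\rm bd},m}=\sqrt{\beta_{\rm bd}}\,\tilde h_{{\rm bd},m}$, where all the $\tilde h$'s are $\mathcal{CN}(0,1)$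 (circularly symmetric complex Gaussian). With RIS phases aligned to the direct channel, the signal-to-interference-plus-noise ratio at the D2D receiver is $$\Gamma_{\rm d}=\frac{\frac{P_{\rm s}}{N_0}\left(|h_{\rm sd}|+\sum_{n=1}^N\alpha|h_{{\rm sr},n}||h_{{\rm rd},n}|\right)^2}{1+\frac{P_{\rm b}}{N_0}\max_{1\le m\le M}|h_{{\rm bd},m}|^2},$$ which depends on the design variables $P_{\rm s}$ (transmit power of the D2D source) and $d$ (RIS location parameter). *)

theory Defs
  imports "HOL-Probability.Probability"
begin

text \<open>Index set of the channel coefficients: a single family over this type lets
  \<open>indep_vars\<close> express the mutual independence of all of them.\<close>

datatype channel = SD | SR nat | RD nat | BD nat

definition channels :: "nat \<Rightarrow> nat \<Rightarrow> channel set" where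
  "channels N M = {SD} \<union> SR ` {1..N} \<union> RD ` {1..N} \<union> BD ` {1..M}"

text \<open>\<open>CN(0, v)\<close>: independent real and imaginary parts, each normal with mean \<open>0\<close> and
  variance \<open>v / 2\<close> (the second argument of \<open>normal_density\<close> is the standard deviation).\<close>

definition circ_complex_normal :: "'a measure \<Rightarrow> real \<Rightarrow> ('a \<Rightarrow> complex) \<Rightarrow> bool" where
  "circ_complex_normal \<mu> v Z \<longleftrightarrow>
     prob_space.indep_var \<mu> borel (\<lambda>\<omega>. Re (Z \<omega>)) borel (\<lambda>\<omega>. Im (Z \<omega>)) \<and>
     distributed \<mu> lborel (\<lambda>\<omega>. Re (Z \<omega>)) (\<lambda>x. ennreal (normal_density 0 (sqrt (v / 2)) x)) \<and>
     distributed \<mu> lborel (\<lambda>\<omega>. Im (Z \<omega>)) (\<lambda>x. ennreal (normal_density 0 (sqrt (v / 2)) x))"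

definition path_loss :: "real \<Rightarrow> real \<Rightarrow> real \<Rightarrow> real" where
  "path_loss d\<^sub>0 \<eta> r = (d\<^sub>0 / r) powr \<eta>"

definition sinr :: "nat \<Rightarrow> nat \<Rightarrow> real \<Rightarrow> real \<Rightarrow> real \<Rightarrow> real \<Rightarrow> (channel \<Rightarrow> complex) \<Rightarrow> real" where
  "sinr N M \<alpha> N\<^sub>0 P\<^sub>b P\<^sub>s h =
     (P\<^sub>s / N\<^sub>0 * (cmod (h SD) + (\<Sum>n=1..N. \<alpha> * cmod (h (SR n)) * cmod (h (RD n))))\<^sup>2)
     / (1 + P\<^sub>b / N\<^sub>0 * (MAX m\<in>{1..M}. (cmod (h (BD m)))\<^sup>2))"

end

theory Submission
  imports Defs
begin

text \<open>For fixed normalized channels, the SINR depends on \<open>(P\<^sub>s, d)\<close> only through \<open>P\<^sub>s\<close> and the cascaded gain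
  \<open>g(d) = sqrt (\<beta>\<^sub>s\<^sub>r \<beta>\<^sub>r\<^sub>d)\<close>, and pointwise it is nondecreasing in both. When one of the two
  strictly grows (and the larger power is positive), the event that the SINR crosses the threshold
  has positive probability, because independent Rayleigh amplitudes charge every box; so both
  \<open>p_out\<close> and the mean react strictly and in opposite directions. Since the constraint set is a
  product, any feasible point that does not maximize both \<open>P\<^sub>s\<close> and \<open>g(d)\<close> is therefore strictly
  improved for both objectives at once, and a point that does is optimal for both.\<close>

section \<open>Amplitudes of complex Gaussians: charged intervals and second moments\<close>

text \<open>If the interval had probability 0, the density would integrate to 0 over it; being
  positive everywhere, it would force the interval to be Lebesgue null.\<close>

lemma (in prob_space) prob_interval_pos:
  fixes X :: "'a \<Rightarrow> real"
  assumes X: "distributed M lborel X (\<lambda>x. ennreal (f x))"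
    and f: "\<And>x. 0 < f x" and "a < b"
  shows "0 < prob (X -` {a<..<b} \<inter> space M)"
proof -
  have [measurable]: "(\<lambda>x. ennreal (f x)) \<in> borel_measurable borel"
    using distributed_borel_measurable[OF X] by simp
  have "emeasure M (X -` {a<..<b} \<inter> space M) \<noteq> 0"
  proof
    assume "emeasure M (X -` {a<..<b} \<inter> space M) = 0"
    then have "(\<integral>\<^sup>+x. ennreal (f x) * indicator {a<..<b} x \<partial>lborel) = 0"
      using distributed_emeasure[OF X, of "{a<..<b}"] by simp
    then have "AE x in lborel. ennreal (f x) * indicator {a<..<b} x = 0"
      by (subst (asm) nn_integral_0_iff_AE) auto
    then have "AE x in lborel. x \<notin> {a<..<b}"
      by eventually_elim (use f in \<open>auto simp: indicator_def ennreal_eq_0_iff simp flip: not_less split: if_splits\<close>)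
    then have "emeasure lborel {a<..<b} = 0"
      by (subst (asm) AE_iff_measurable[where N="{a<..<b}"]) auto
    then show False using \<open>a < b\<close> by simp
  qed
  then show ?thesis
    by (simp add: emeasure_eq_measure zero_less_measure_iff)
qed

text \<open>A rectangle fits inside the annulus, and independence of real and imaginary part makes
  its probability a product of two positive factors.\<close>

lemma (in prob_space) circ_complex_normal_annulus_pos:
  assumes Z: "circ_complex_normal M v Z" and "0 < v" "0 \<le> a" "a < b"
  shows "0 < prob ((\<lambda>\<omega>. cmod (Z \<omega>)) -` {a<..<b} \<inter> space M)"
proof -
  have ind: "indep_var borel (\<lambda>\<omega>. Re (Z \<omega>)) borel (\<lambda>\<omega>. Im (Z \<omega>))"
    and Re: "distributed M lborel (\<lambda>\<omega>. Re (Z \<omega>)) (\<lambda>x. ennreal (normal_density 0 (sqrt (v / 2)) x))"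
    and Im: "distributed M lborel (\<lambda>\<omega>. Im (Z \<omega>)) (\<lambda>x. ennreal (normal_density 0 (sqrt (v / 2)) x))"
    using Z unfolding circ_complex_normal_def by auto
  have [measurable]: "(\<lambda>\<omega>. Re (Z \<omega>)) \<in> borel_measurable M" "(\<lambda>\<omega>. Im (Z \<omega>)) \<in> borel_measurable M"
    using distributed_measurable[OF Re] distributed_measurable[OF Im] by simp_all
  \<comment> \<open>The corner \<open>(m, w)\<close> lies on the circle of radius \<open>b\<close>,
    so the open rectangle with sides \<open>{a<..<m}\<close> and \<open>{0<..<w}\<close> stays
    inside that circle, while its real part alone exceeds \<open>a\<close>.\<close>
  define m where "m = (a + b) / 2"
  define w where "w = sqrt (b\<^sup>2 - m\<^sup>2)"
  have m: "a < m" "m < b" "0 < m" using assms by (auto simp: m_def)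
  have "m\<^sup>2 < b\<^sup>2" using m by (intro power_strict_mono) auto
  then have w: "0 < w" "w\<^sup>2 = b\<^sup>2 - m\<^sup>2" by (auto simp: w_def)
  let ?B = "(\<lambda>\<omega>. (Re (Z \<omega>), Im (Z \<omega>))) -` ({a<..<m} \<times> {0<..<w}) \<inter> space M"
  have pos: "\<And>x. 0 < normal_density 0 (sqrt (v / 2)) x"
    using \<open>0 < v\<close> by (intro normal_density_pos) simp
  have "prob ?B = prob ((\<lambda>\<omega>. Re (Z \<omega>)) -` {a<..<m} \<inter> space M) *
      prob ((\<lambda>\<omega>. Im (Z \<omega>)) -` {0<..<w} \<inter> space M)"
    by (rule indep_varD[OF ind]) auto
  also have "\<dots> > 0"
    using prob_interval_pos[OF Re pos m(1)] prob_interval_pos[OF Im pos w(1)] by simp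
  finally have "0 < prob ?B" .
  also have "prob ?B \<le> prob ((\<lambda>\<omega>. cmod (Z \<omega>)) -` {a<..<b} \<inter> space M)"
  proof (rule finite_measure_mono)
    have [measurable]: "(\<lambda>\<omega>. cmod (Z \<omega>)) \<in> borel_measurable M"
      unfolding cmod_def by measurable
    show "(\<lambda>\<omega>. cmod (Z \<omega>)) -` {a<..<b} \<inter> space M \<in> events" by measurable
    show "?B \<subseteq> (\<lambda>\<omega>. cmod (Z \<omega>)) -` {a<..<b} \<inter> space M"
    proof
      fix \<omega> assume "\<omega> \<in> ?B"
      then have Re_in: "Re (Z \<omega>) \<in> {a<..<m}" and Im_in: "Im (Z \<omega>) \<in> {0<..<w}"
        and "\<omega> \<in> space M" by auto
      have "a < Re (Z \<omega>)" using Re_in by simp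
      also have "\<dots> \<le> cmod (Z \<omega>)" by (rule complex_Re_le_cmod)
      finally have lower: "a < cmod (Z \<omega>)" .
      have "(Re (Z \<omega>))\<^sup>2 < m\<^sup>2" "(Im (Z \<omega>))\<^sup>2 < w\<^sup>2"
        using Re_in Im_in \<open>0 \<le> a\<close> by (auto intro!: power_strict_mono)
      then have "(cmod (Z \<omega>))\<^sup>2 < b\<^sup>2" using w by (simp add: cmod_power2)
      then have "cmod (Z \<omega>) < b" using m by (intro power2_less_imp_less[of _ b]) auto
      with lower \<open>\<omega> \<in> space M\<close> show "\<omega> \<in> (\<lambda>\<omega>. cmod (Z \<omega>)) -` {a<..<b} \<inter> space M" by simp
    qed
  qed
  finally show ?thesis .
qed

lemma (in prob_space) circ_complex_normal_integrable_square:
  assumes Z: "circ_complex_normal M v Z" and "0 < v"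
  shows "integrable M (\<lambda>\<omega>. (cmod (Z \<omega>))\<^sup>2)"
proof -
  let ?f = "normal_density 0 (sqrt (v / 2))"
  have "integrable M (\<lambda>\<omega>. (X \<omega>)\<^sup>2)" if X: "distributed M lborel X (\<lambda>x. ennreal (?f x))" for X
    using distributed_integrable[OF X, of "\<lambda>x. x\<^sup>2"] integrable_normal_moment[of "sqrt (v / 2)" 0 2]
      \<open>0 < v\<close> by simp
  with Z show ?thesis
    unfolding circ_complex_normal_def cmod_power2 by (intro Bochner_Integration.integrable_add) auto
qed

section \<open>The SINR as a function of amplitudes: monotonicity and integrability\<close>

text \<open>Here \<open>r c\<close> stands for the modulus of a normalized channel, and
  \<open>a\<close>, \<open>b\<close> for the square roots of the path losses of the direct and the
  interfering links. The Gaussian law enters only through charged intervals and finite second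
  moments.\<close>

locale ris_fading = prob_space \<mu> for \<mu> :: "'a measure" +
  fixes r :: "channel \<Rightarrow> 'a \<Rightarrow> real"
    and N M :: nat and \<alpha> N\<^sub>0 P\<^sub>b a b :: real
  assumes indep: "indep_vars (\<lambda>_. borel) r (channels N M)"
    and amplitude_nonneg: "\<And>c \<omega>. 0 \<le> r c \<omega>"
    and amplitude_interval_pos: "\<And>c s t. c \<in> channels N M \<Longrightarrow> 0 \<le> s \<Longrightarrow> s < t \<Longrightarrow>
        0 < prob (r c -` {s<..<t} \<inter> space \<mu>)"
    and integrable_amplitude_square: "\<And>c. c \<in> channels N M \<Longrightarrow> integrable \<mu> (\<lambda>\<omega>. (r c \<omega>)\<^sup>2)"
    and NM: "1 \<le> N" "1 \<le> M"
    and consts_pos: "0 < \<alpha>" "0 < N\<^sub>0" "0 < P\<^sub>b" "0 < a" "0 < b"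
begin

text \<open>The RIS location acts only through the factor \<open>g\<close> in front of the cascaded
  sum. The argument \<open>u\<close> is a deterministic amplitude vector, so that random and
  hand-picked amplitudes can be compared.\<close>

definition snr :: "real \<Rightarrow> real \<Rightarrow> (channel \<Rightarrow> real) \<Rightarrow> real" where
  "snr P g u = (P / N\<^sub>0 * (a * u SD + g * (\<Sum>n=1..N. \<alpha> * u (SR n) * u (RD n)))\<^sup>2)
     / (1 + P\<^sub>b / N\<^sub>0 * (MAX m\<in>{1..M}. (b * u (BD m))\<^sup>2))"

lemma measurable_amplitude: "c \<in> channels N M \<Longrightarrow> r c \<in> borel_measurable \<mu>"
  using indep by (auto simp: indep_vars_def)

lemma channels_mem [simp]:
  "SD \<in> channels N M" "SR n \<in> channels N M \<longleftrightarrow> n \<in> {1..N}"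
  "RD n \<in> channels N M \<longleftrightarrow> n \<in> {1..N}" "BD n \<in> channels N M \<longleftrightarrow> n \<in> {1..M}"
  by (auto simp: channels_def)

lemma channels_nonempty [simp]: "channels N M \<noteq> {}"
  by (simp add: channels_def)

lemma finite_channels: "finite (channels N M)"
  by (simp add: channels_def)

text \<open>The numerator grows with power, gain and signal amplitudes, the denominator with the
  interfering amplitudes; hence the reversed inequality for \<open>BD\<close>. Nonnegativity makes
  products and squares monotone.\<close>

lemma snr_mono:
  assumes "0 \<le> P" "P \<le> P'" "0 \<le> g" "g \<le> g'"
    and u: "\<And>c. c \<in> channels N M \<Longrightarrow> 0 \<le> u c" "\<And>c. c \<in> channels N M \<Longrightarrow> 0 \<le> w c"
    and "u SD \<le> w SD"
    and "\<And>n. n \<in> {1..N} \<Longrightarrow> u (SR n) \<le> w (SR n)" "\<And>n. n \<in> {1..N} \<Longrightarrow> u (RD n) \<le> w (RD n)"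
    and "\<And>m. m \<in> {1..M} \<Longrightarrow> w (BD m) \<le> u (BD m)"
  shows "snr P g u \<le> snr P' g' w"
proof -
  have sum_le: "(\<Sum>n=1..N. \<alpha> * u (SR n) * u (RD n)) \<le> (\<Sum>n=1..N. \<alpha> * w (SR n) * w (RD n))"
    using assms consts_pos by (intro sum_mono mult_mono) auto
  have sum_nonneg: "0 \<le> (\<Sum>n=1..N. \<alpha> * u (SR n) * u (RD n))"
    using u consts_pos by (intro sum_nonneg mult_nonneg_nonneg) auto
  have max_le: "(MAX m\<in>{1..M}. (b * w (BD m))\<^sup>2) \<le> (MAX m\<in>{1..M}. (b * u (BD m))\<^sup>2)"
  proof (rule Max.boundedI)
    fix z assume "z \<in> (\<lambda>m. (b * w (BD m))\<^sup>2) ` {1..M}"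
    then obtain m where m: "m \<in> {1..M}" "z = (b * w (BD m))\<^sup>2" by auto
    have "z \<le> (b * u (BD m))\<^sup>2"
      using m assms consts_pos by (auto intro!: power_mono mult_left_mono mult_nonneg_nonneg)
    also have "\<dots> \<le> (MAX m\<in>{1..M}. (b * u (BD m))\<^sup>2)"
      using m by (intro Max_ge) auto
    finally show "z \<le> (MAX m\<in>{1..M}. (b * u (BD m))\<^sup>2)" .
  qed (use NM in auto)
  \<comment> \<open>One interferer exists, so the maximum dominates a square; both denominators are
    therefore positive.\<close>
  have "0 \<le> (b * w (BD 1))\<^sup>2" by simp
  also have "\<dots> \<le> (MAX m\<in>{1..M}. (b * w (BD m))\<^sup>2)"
    using NM by (intro Max_ge) auto
  finally have max_nonneg: "0 \<le> (MAX m\<in>{1..M}. (b * w (BD m))\<^sup>2)" .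
  show ?thesis
    unfolding snr_def
    using sum_le sum_nonneg max_le max_nonneg assms consts_pos u
    by (intro frac_le mult_mono power_mono add_mono divide_right_mono add_pos_nonneg)
       (auto intro!: mult_nonneg_nonneg add_nonneg_nonneg)
qed

lemma measurable_snr: "(\<lambda>\<omega>. snr P g (\<lambda>c. r c \<omega>)) \<in> borel_measurable \<mu>"
  unfolding snr_def
  by (intro borel_measurable_divide borel_measurable_times borel_measurable_power
      borel_measurable_add borel_measurable_sum borel_measurable_Max borel_measurable_const)
     (auto intro: measurable_amplitude)

text \<open>The denominator is at least 1, so the numerator dominates, and it is bounded by a linear
  combination of squared amplitudes and of products of two independent ones.\<close>

lemma integrable_snr:
  assumes "0 \<le> P"
  shows "integrable \<mu> (\<lambda>\<omega>. snr P g (\<lambda>c. r c \<omega>))"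
proof -
  let ?S = "\<lambda>\<omega>. \<Sum>n=1..N. \<alpha> * r (SR n) \<omega> * r (RD n) \<omega>"
  have prod_int: "integrable \<mu> (\<lambda>\<omega>. (r (SR n) \<omega>)\<^sup>2 * (r (RD n) \<omega>)\<^sup>2)" if n: "n \<in> {1..N}" for n
  proof -
    have "indep_vars (\<lambda>_. borel) (\<lambda>c \<omega>. (r c \<omega>)\<^sup>2) (channels N M)"
      by (rule indep_vars_compose2[OF indep]) simp
    then have "indep_vars (\<lambda>_. borel) (\<lambda>c \<omega>. (r c \<omega>)\<^sup>2) {SR n, RD n}"
      by (rule indep_vars_subset) (use n in simp)
    then have "integrable \<mu> (\<lambda>\<omega>. \<Prod>c\<in>{SR n, RD n}. (r c \<omega>)\<^sup>2)"
      by (rule indep_vars_integrable[rotated])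
         (use n integrable_amplitude_square[of "SR n"] integrable_amplitude_square[of "RD n"] in auto)
    then show ?thesis by simp
  qed
  let ?B = "\<lambda>\<omega>. P / N\<^sub>0 * (2 * (a\<^sup>2 * (r SD \<omega>)\<^sup>2 +
      g\<^sup>2 * ((\<Sum>n=1..N. \<alpha>\<^sup>2 * ((r (SR n) \<omega>)\<^sup>2 * (r (RD n) \<omega>)\<^sup>2)) * N)))"
  have "integrable \<mu> ?B"
    using prod_int integrable_amplitude_square[of SD]
    by (intro integrable_mult_right Bochner_Integration.integrable_add integrable_mult_left
        Bochner_Integration.integrable_sum) auto
  then show ?thesis
  proof (rule Bochner_Integration.integrable_bound[OF _ measurable_snr])
    show "AE \<omega> in \<mu>. norm (snr P g (\<lambda>c. r c \<omega>)) \<le> norm (?B \<omega>)"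
    proof (intro AE_I2)
      fix \<omega>
      have "0 \<le> (b * r (BD 1) \<omega>)\<^sup>2" by simp
      also have "\<dots> \<le> (MAX m\<in>{1..M}. (b * r (BD m) \<omega>)\<^sup>2)"
        using NM by (intro Max_ge) auto
      finally have den: "1 \<le> 1 + P\<^sub>b / N\<^sub>0 * (MAX m\<in>{1..M}. (b * r (BD m) \<omega>)\<^sup>2)"
        using consts_pos by simp
      \<comment> \<open>Cauchy-Schwarz against the constant vector 1 of length
        \<open>N\<close>.\<close>
      have sum_sq: "(?S \<omega>)\<^sup>2 \<le> (\<Sum>n=1..N. \<alpha>\<^sup>2 * ((r (SR n) \<omega>)\<^sup>2 * (r (RD n) \<omega>)\<^sup>2)) * N"
        using sum_squared_le_sum_of_squares[of "\<lambda>n. \<alpha> * r (SR n) \<omega> * r (RD n) \<omega>" "{1..N}"]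
        by (simp add: power_mult_distrib mult.assoc)
      have "(a * r SD \<omega> + g * ?S \<omega>)\<^sup>2 \<le> 2 * ((a * r SD \<omega>)\<^sup>2 + (g * ?S \<omega>)\<^sup>2)"
        using sum_squares_bound[of "a * r SD \<omega>" "g * ?S \<omega>"] by (simp add: power2_sum)
      also have "\<dots> \<le> 2 * (a\<^sup>2 * (r SD \<omega>)\<^sup>2 +
          g\<^sup>2 * ((\<Sum>n=1..N. \<alpha>\<^sup>2 * ((r (SR n) \<omega>)\<^sup>2 * (r (RD n) \<omega>)\<^sup>2)) * N))"
        using sum_sq unfolding power_mult_distrib
        by (intro mult_left_mono add_left_mono) auto
      finally have "P / N\<^sub>0 * (a * r SD \<omega> + g * ?S \<omega>)\<^sup>2 \<le> ?B \<omega>"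
        using assms consts_pos by (intro mult_left_mono) auto
      moreover have "snr P g (\<lambda>c. r c \<omega>) \<le> (P / N\<^sub>0 * (a * r SD \<omega> + g * ?S \<omega>)\<^sup>2) / 1"
        unfolding snr_def using den assms consts_pos by (intro divide_left_mono) auto
      moreover have "0 \<le> snr P g (\<lambda>c. r c \<omega>)"
        unfolding snr_def using den assms consts_pos by (intro divide_nonneg_nonneg) auto
      ultimately have bounds: "0 \<le> snr P g (\<lambda>c. r c \<omega>)" "snr P g (\<lambda>c. r c \<omega>) \<le> ?B \<omega>"
        unfolding div_by_1 by (blast intro: order_trans)+
      show "norm (snr P g (\<lambda>c. r c \<omega>)) \<le> norm (?B \<omega>)"
        unfolding real_norm_def abs_of_nonneg[OF bounds(1)]
        by (rule order_trans[OF bounds(2) abs_ge_self])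
    qed
  qed
qed

section \<open>Positive probability of crossing the threshold\<close>

lemma prob_box_pos:
  assumes "\<And>c. c \<in> channels N M \<Longrightarrow> 0 \<le> s c \<and> s c < t c"
  shows "0 < prob (\<Inter>c\<in>channels N M. r c -` {s c<..<t c} \<inter> space \<mu>)"
proof -
  have "prob (\<Inter>c\<in>channels N M. r c -` {s c<..<t c} \<inter> space \<mu>)
      = (\<Prod>c\<in>channels N M. prob (r c -` {s c<..<t c} \<inter> space \<mu>))"
    using finite_channels by (intro indep_varsD_finite[OF indep]) auto
  also have "\<dots> > 0"
    using assms amplitude_interval_pos by (intro prod_pos) auto
  finally show ?thesis .
qed

text \<open>Giving all signal links the amplitude \<open>t\<close> and all interferers the amplitude
  \<open>e\<close> reduces the search for a separating amplitude vector to one-variable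
  calculus.\<close>

definition diag_snr :: "real \<Rightarrow> real \<Rightarrow> real \<Rightarrow> real \<Rightarrow> real" where
  "diag_snr P g t e = snr P g (\<lambda>c. case c of BD _ \<Rightarrow> e | _ \<Rightarrow> t)"

lemma diag_snr_eq:
  "diag_snr P g t e = (P / N\<^sub>0 * (a * t + g * (N * \<alpha> * t\<^sup>2))\<^sup>2) / (1 + P\<^sub>b / N\<^sub>0 * (b * e)\<^sup>2)"
proof -
  have "(\<lambda>m. (b * e)\<^sup>2) ` {1..M} = {(b * e)\<^sup>2}" using NM by auto
  then show ?thesis
    by (simp add: diag_snr_def snr_def power2_eq_square algebra_simps)
qed

lemma diag_snr_tendsto:
  assumes "(f \<longlongrightarrow> t) F" "(e \<longlongrightarrow> 0) F"
  shows "((\<lambda>x. diag_snr P g (f x) (e x)) \<longlongrightarrow> diag_snr P g t 0) F"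
  unfolding diag_snr_eq
  by (intro tendsto_intros assms) simp

text \<open>Without interference the denominator is 1. At \<open>t > 0\<close> both the direct and
  the cascaded term have positive coefficients, so a larger power or gain shows up strictly; a gain
  increase needs the positive power \<open>P'\<close> to be visible.\<close>

lemma diag_snr_strict_mono:
  assumes "0 \<le> P" "P \<le> P'" "0 \<le> g" "g \<le> g'" "0 < P'" "P < P' \<or> g < g'" "0 < t"
  shows "diag_snr P g t 0 < diag_snr P' g' t 0"
proof -
  have at: "0 < a * t" and k: "0 < N * \<alpha> * t\<^sup>2" using assms consts_pos NM by auto
  have pos: "0 < (a * t + g * (N * \<alpha> * t\<^sup>2))"
    using at k \<open>0 \<le> g\<close> by (intro add_pos_nonneg) auto
  have sq_le: "(a * t + g * (N * \<alpha> * t\<^sup>2))\<^sup>2 \<le> (a * t + g' * (N * \<alpha> * t\<^sup>2))\<^sup>2"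
    using pos k assms by (intro power_mono add_left_mono mult_right_mono) auto
  have "P * (a * t + g * (N * \<alpha> * t\<^sup>2))\<^sup>2 < P' * (a * t + g' * (N * \<alpha> * t\<^sup>2))\<^sup>2"
  proof (cases "P < P'")
    case True
    then show ?thesis using sq_le pos assms by (intro mult_less_le_imp_less) auto
  next
    case False
    then have "P = P'" "g < g'" using assms by auto
    then have "(a * t + g * (N * \<alpha> * t\<^sup>2))\<^sup>2 < (a * t + g' * (N * \<alpha> * t\<^sup>2))\<^sup>2"
      using pos k by (intro power_strict_mono add_strict_left_mono mult_strict_right_mono) auto
    then show ?thesis using \<open>P = P'\<close> \<open>0 < P'\<close> by simp
  qed
  then show ?thesis
    using consts_pos by (simp add: diag_snr_eq divide_strict_right_mono)
qed

text \<open>The intermediate value theorem is applied to the sum \<open>?W\<close> of the two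
  curves: where it equals \<open>2 * \<gamma>\<close>, the threshold is the mean of two distinct
  values and so lies strictly between them.\<close>

lemma exists_separating_amplitude:
  assumes "0 \<le> P" "P \<le> P'" "0 \<le> g" "g \<le> g'" "0 < P'" "P < P' \<or> g < g'" "0 < \<gamma>"
  shows "\<exists>t>0. diag_snr P g t 0 < \<gamma> \<and> \<gamma> < diag_snr P' g' t 0"
proof -
  let ?W = "\<lambda>t. diag_snr P g t 0 + diag_snr P' g' t 0"
  \<comment> \<open>At \<open>T\<close> the direct link with power \<open>P'\<close> alone already
    contributes \<open>2 * \<gamma>\<close>, which bounds \<open>?W T\<close> from below.\<close>
  define T where "T = sqrt (2 * \<gamma> * N\<^sub>0 / P') / a"
  have T: "0 \<le> T" "(a * T)\<^sup>2 = 2 * \<gamma> * N\<^sub>0 / P'"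
    using assms consts_pos by (auto simp: T_def)
  have "(a * T)\<^sup>2 \<le> (a * T + g' * (N * \<alpha> * T\<^sup>2))\<^sup>2"
    using T assms consts_pos by (intro power_mono) auto
  then have "P' / N\<^sub>0 * (a * T)\<^sup>2 \<le> diag_snr P' g' T 0"
    using assms consts_pos unfolding diag_snr_eq by (simp add: divide_right_mono)
  moreover have "P' / N\<^sub>0 * (a * T)\<^sup>2 = 2 * \<gamma>"
    using T assms consts_pos by simp
  moreover have "0 \<le> diag_snr P g T 0"
    using assms consts_pos by (simp add: diag_snr_eq)
  ultimately have "2 * \<gamma> \<le> ?W T" by simp
  moreover have "?W 0 \<le> 2 * \<gamma>" using assms by (simp add: diag_snr_eq)
  moreover have "continuous_on {0..T} ?W"
    unfolding diag_snr_eq by (intro continuous_intros) auto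
  ultimately obtain t where t: "0 \<le> t" "?W t = 2 * \<gamma>"
    using IVT'[of ?W 0 "2 * \<gamma>" T] T by auto
  have "t \<noteq> 0" using t assms by (auto simp: diag_snr_eq)
  then have "0 < t" using t by simp
  moreover have "diag_snr P g t 0 < diag_snr P' g' t 0"
    using assms \<open>0 < t\<close> by (intro diag_snr_strict_mono)
  ultimately show ?thesis using t by (intro exI[of _ t]) auto
qed

text \<open>The strict separation at signal amplitude \<open>t\<close> without interference
  survives, by continuity, on a small box of amplitudes, and such a box has positive
  probability.\<close>

lemma prob_crossing_pos:
  assumes *: "0 \<le> P" "P \<le> P'" "0 \<le> g" "g \<le> g'" "0 < P'" "P < P' \<or> g < g'" "0 < \<gamma>"
  shows "0 < prob {\<omega> \<in> space \<mu>. snr P g (\<lambda>c. r c \<omega>) \<le> \<gamma> \<and> \<gamma> < snr P' g' (\<lambda>c. r c \<omega>)}"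
proof -
  obtain t where t: "0 < t" "diag_snr P g t 0 < \<gamma>" "\<gamma> < diag_snr P' g' t 0"
    using exists_separating_amplitude[OF *] by auto
  have lims: "((\<lambda>e. t + e) \<longlongrightarrow> t) (at_right 0)" "((\<lambda>e. t - e) \<longlongrightarrow> t) (at_right 0)"
    "((\<lambda>e. e) \<longlongrightarrow> 0) (at_right (0::real))" "((\<lambda>e. 0) \<longlongrightarrow> 0) (at_right (0::real))"
    by (auto intro!: tendsto_eq_intros)
  \<comment> \<open>By monotonicity the extremes over the box sit at corners: the weaker
    configuration is tested at its most favourable corner, and the stronger one, next, at its least
    favourable.\<close>
  have "eventually (\<lambda>e. diag_snr P g (t + e) 0 < \<gamma>) (at_right 0)"
    using order_tendstoD(2)[OF diag_snr_tendsto[OF lims(1,4)] t(2)] .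
  moreover have "eventually (\<lambda>e. \<gamma> < diag_snr P' g' (t - e) e) (at_right 0)"
    using order_tendstoD(1)[OF diag_snr_tendsto[OF lims(2,3)] t(3)] .
  \<comment> \<open>This keeps the lower edges \<open>t - e\<close> nonnegative, as amplitudes and
    \<open>prob_box_pos\<close> demand.\<close>
  moreover have "eventually (\<lambda>e. e < t) (at_right 0)"
    using order_tendstoD(2)[OF lims(3) t(1)] .
  moreover have "eventually (\<lambda>e::real. 0 < e) (at_right 0)"
    by (simp add: eventually_at_right_less)
  ultimately have "eventually (\<lambda>e. 0 < e \<and> e < t \<and> diag_snr P g (t + e) 0 < \<gamma> \<and>
      \<gamma> < diag_snr P' g' (t - e) e) (at_right 0)"
    by eventually_elim auto
  then obtain e where e: "0 < e" "e < t" "diag_snr P g (t + e) 0 < \<gamma>" "\<gamma> < diag_snr P' g' (t - e) e"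
    using eventually_happens[of _ "at_right (0::real)"] by (auto simp: trivial_limit_at_right_real)
  define lo hi where "lo = (\<lambda>c. case c of BD _ \<Rightarrow> 0 | _ \<Rightarrow> t - e)"
    and "hi = (\<lambda>c. case c of BD _ \<Rightarrow> e | _ \<Rightarrow> t + e)"
  let ?B = "\<Inter>c\<in>channels N M. r c -` {lo c<..<hi c} \<inter> space \<mu>"
  have "0 < prob ?B"
    using e by (intro prob_box_pos) (auto simp: lo_def hi_def split: channel.splits)
  also have "prob ?B \<le> prob {\<omega> \<in> space \<mu>. snr P g (\<lambda>c. r c \<omega>) \<le> \<gamma> \<and> \<gamma> < snr P' g' (\<lambda>c. r c \<omega>)}"
  proof (rule finite_measure_mono)
    have [measurable]: "\<And>P g. (\<lambda>\<omega>. snr P g (\<lambda>c. r c \<omega>)) \<in> borel_measurable \<mu>"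
      by (rule measurable_snr)
    show "{\<omega> \<in> space \<mu>. snr P g (\<lambda>c. r c \<omega>) \<le> \<gamma> \<and> \<gamma> < snr P' g' (\<lambda>c. r c \<omega>)} \<in> events"
      by measurable
    show "?B \<subseteq> {\<omega> \<in> space \<mu>. snr P g (\<lambda>c. r c \<omega>) \<le> \<gamma> \<and> \<gamma> < snr P' g' (\<lambda>c. r c \<omega>)}"
    proof
      fix \<omega> assume \<omega>: "\<omega> \<in> ?B"
      have box: "lo c < r c \<omega>" "r c \<omega> < hi c" if "c \<in> channels N M" for c
        using \<omega> that by auto
      have "\<omega> \<in> space \<mu>" using \<omega> channels_mem(1) by blast
      have SD: "t - e < r SD \<omega>" "r SD \<omega> < t + e"
        using box[of SD] by (simp_all add: lo_def hi_def)
      have SR: "t - e < r (SR n) \<omega>" "r (SR n) \<omega> < t + e" if "n \<in> {1..N}" for n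
        using box[of "SR n"] that by (simp_all add: lo_def hi_def)
      have RD: "t - e < r (RD n) \<omega>" "r (RD n) \<omega> < t + e" if "n \<in> {1..N}" for n
        using box[of "RD n"] that by (simp_all add: lo_def hi_def)
      have BD: "0 < r (BD n) \<omega>" "r (BD n) \<omega> < e" if "n \<in> {1..M}" for n
        using box[of "BD n"] that by (simp_all add: lo_def hi_def)
      have "snr P g (\<lambda>c. r c \<omega>) \<le> diag_snr P g (t + e) 0"
        unfolding diag_snr_def using * e SD SR RD BD
        by (intro snr_mono)
           (auto simp: amplitude_nonneg less_imp_le split: channel.splits)
      moreover have "diag_snr P' g' (t - e) e \<le> snr P' g' (\<lambda>c. r c \<omega>)"
        unfolding diag_snr_def using * e SD SR RD BD
        by (intro snr_mono)
           (auto simp: amplitude_nonneg less_imp_le split: channel.splits)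
      ultimately show "\<omega> \<in> {\<omega> \<in> space \<mu>. snr P g (\<lambda>c. r c \<omega>) \<le> \<gamma> \<and> \<gamma> < snr P' g' (\<lambda>c. r c \<omega>)}"
        using e \<open>\<omega> \<in> space \<mu>\<close> by auto
    qed
  qed
  finally show ?thesis .
qed

section \<open>Weak and strict monotonicity of outage and mean\<close>

definition outage :: "real \<Rightarrow> real \<Rightarrow> real \<Rightarrow> real" where
  "outage \<gamma> P g = prob {\<omega> \<in> space \<mu>. snr P g (\<lambda>c. r c \<omega>) \<le> \<gamma>}"

definition mean_snr :: "real \<Rightarrow> real \<Rightarrow> real" where
  "mean_snr P g = expectation (\<lambda>\<omega>. snr P g (\<lambda>c. r c \<omega>))"

lemma snr_amplitude_mono:
  assumes "0 \<le> P" "P \<le> P'" "0 \<le> g" "g \<le> g'"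
  shows "snr P g (\<lambda>c. r c \<omega>) \<le> snr P' g' (\<lambda>c. r c \<omega>)"
  using assms by (intro snr_mono) (auto simp: amplitude_nonneg)

lemma outage_antimono:
  assumes "0 \<le> P" "P \<le> P'" "0 \<le> g" "g \<le> g'"
  shows "outage \<gamma> P' g' \<le> outage \<gamma> P g"
proof -
  have [measurable]: "\<And>P g. (\<lambda>\<omega>. snr P g (\<lambda>c. r c \<omega>)) \<in> borel_measurable \<mu>"
    by (rule measurable_snr)
  show ?thesis
    unfolding outage_def
    using snr_amplitude_mono[OF assms] by (intro finite_measure_mono) (auto intro: order_trans)
qed

lemma mean_snr_mono:
  assumes "0 \<le> P" "P \<le> P'" "0 \<le> g" "g \<le> g'"
  shows "mean_snr P g \<le> mean_snr P' g'"
  unfolding mean_snr_def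
  using assms by (intro integral_mono integrable_snr snr_amplitude_mono) auto

text \<open>The weaker outage event is the disjoint union of the stronger one and the crossing
  event, which has positive probability.\<close>

lemma outage_strict_antimono:
  assumes "0 \<le> P" "P \<le> P'" "0 \<le> g" "g \<le> g'" "0 < P'" "P < P' \<or> g < g'" "0 < \<gamma>"
  shows "outage \<gamma> P' g' < outage \<gamma> P g"
proof -
  have [measurable]: "\<And>P g. (\<lambda>\<omega>. snr P g (\<lambda>c. r c \<omega>)) \<in> borel_measurable \<mu>"
    by (rule measurable_snr)
  let ?C = "{\<omega> \<in> space \<mu>. snr P g (\<lambda>c. r c \<omega>) \<le> \<gamma> \<and> \<gamma> < snr P' g' (\<lambda>c. r c \<omega>)}"
  let ?O = "\<lambda>P g. {\<omega> \<in> space \<mu>. snr P g (\<lambda>c. r c \<omega>) \<le> \<gamma>}"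
  have "?O P g = ?O P' g' \<union> ?C"
    using snr_amplitude_mono[OF assms(1-4)] by (auto intro: order_trans)
  moreover have "prob (?O P' g' \<union> ?C) = prob (?O P' g') + prob ?C"
    by (intro finite_measure_Union) auto
  ultimately show ?thesis
    using prob_crossing_pos[OF assms] by (simp add: outage_def)
qed

lemma mean_snr_strict_mono:
  assumes "0 \<le> P" "P \<le> P'" "0 \<le> g" "g \<le> g'" "0 < P'" "P < P' \<or> g < g'"
  shows "mean_snr P g < mean_snr P' g'"
proof -
  have [measurable]: "\<And>P g. (\<lambda>\<omega>. snr P g (\<lambda>c. r c \<omega>)) \<in> borel_measurable \<mu>"
    by (rule measurable_snr)
  \<comment> \<open>The level 1 is arbitrary: a crossing of any positive level makes the ordered
    integrands differ on a set of positive measure.\<close>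
  let ?C = "{\<omega> \<in> space \<mu>. snr P g (\<lambda>c. r c \<omega>) \<le> 1 \<and> 1 < snr P' g' (\<lambda>c. r c \<omega>)}"
  show ?thesis
    unfolding mean_snr_def
  proof (rule integral_less_AE[where A="?C"])
    show "emeasure \<mu> ?C \<noteq> 0"
      using prob_crossing_pos[OF assms zero_less_one] by (simp add: emeasure_eq_measure)
  qed (use assms integrable_snr snr_amplitude_mono[OF assms(1-4)] in auto)
qed

end

section \<open>Equivalence of the two optimization problems\<close>

text \<open>A simultaneous strict improvement refutes both optimality claims, and simultaneous
  optimality proves both.\<close>

lemma is_arg_min_iff_is_arg_max:
  fixes p q :: "'b \<Rightarrow> real"
  assumes "(\<exists>z\<in>F. p z < p x \<and> q x < q z) \<or> (\<forall>z\<in>F. p x \<le> p z \<and> q z \<le> q x)"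
  shows "is_arg_min p (\<lambda>z. z \<in> F) x \<longleftrightarrow> is_arg_max q (\<lambda>z. z \<in> F) x"
  using assms unfolding is_arg_min_def is_arg_max_def by (meson not_le)

theorem lemma2:
  fixes N M :: nat
    and d\<^sub>0 d_sd d_bd \<eta> \<delta> y \<alpha> N\<^sub>0 P_b P_s_max I_th \<gamma>_th :: real
    and \<mu> :: "'a measure"
    and h' :: "channel \<Rightarrow> 'a \<Rightarrow> complex"
    and h_sc :: "'a \<Rightarrow> complex"
    and \<beta> :: "real \<Rightarrow> channel \<Rightarrow> real"
    and h :: "real \<Rightarrow> channel \<Rightarrow> 'a \<Rightarrow> complex"
    and \<Gamma>_d :: "real \<times> real \<Rightarrow> 'a \<Rightarrow> real"
    and p_out mean_sinr :: "real \<times> real \<Rightarrow> real"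
    and F :: "(real \<times> real) set"
  defines "\<beta> \<equiv> \<lambda>d c. path_loss d\<^sub>0 \<eta> (case c of
               SD \<Rightarrow> d_sd
             | SR _ \<Rightarrow> sqrt (d\<^sup>2 + y\<^sup>2)
             | RD _ \<Rightarrow> sqrt ((d_sd - d)\<^sup>2 + y\<^sup>2)
             | BD _ \<Rightarrow> d_bd)"
    and "h \<equiv> \<lambda>d c \<omega>. of_real (sqrt (\<beta> d c)) * h' c \<omega>"
    and "\<Gamma>_d \<equiv> \<lambda>(P_s, d) \<omega>. sinr N M \<alpha> N\<^sub>0 P_b P_s (\<lambda>c. h d c \<omega>)"
    and "p_out \<equiv> \<lambda>x. measure \<mu> {\<omega> \<in> space \<mu>. \<Gamma>_d x \<omega> \<le> \<gamma>_th}"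
    and "mean_sinr \<equiv> \<lambda>x. integral\<^sup>L \<mu> (\<Gamma>_d x)"
    and "F \<equiv> {(P_s, d). P_s * (\<integral>\<omega>. (cmod (h_sc \<omega>))\<^sup>2 \<partial>\<mu>) \<le> I_th \<and>
                 0 \<le> P_s \<and> P_s \<le> P_s_max \<and>
                 sqrt (\<delta>\<^sup>2 - y\<^sup>2) \<le> d \<and> d \<le> d_sd - sqrt (\<delta>\<^sup>2 - y\<^sup>2)}"
  assumes "prob_space \<mu>"
    and "N \<ge> 1" and "M \<ge> 1"
    and "d\<^sub>0 > 0" and "d_sd > 0" and "d_bd > 0" and "\<eta> > 0" and "\<delta> > 0"
    and "N\<^sub>0 > 0" and "P_b > 0" and "P_s_max > 0" and "I_th > 0" and "\<gamma>_th > 0"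
    and "0 < \<alpha>" and "\<alpha> \<le> 1"
    and "0 \<le> y" and "y \<le> \<delta>"
    and "h_sc \<in> borel_measurable \<mu>"
    and "integrable \<mu> (\<lambda>\<omega>. (cmod (h_sc \<omega>))\<^sup>2)"
    and "(\<integral>\<omega>. (cmod (h_sc \<omega>))\<^sup>2 \<partial>\<mu>) > 0"
    and "prob_space.indep_vars \<mu> (\<lambda>_. borel) h' (channels N M)"
    and "\<And>c. c \<in> channels N M \<Longrightarrow> circ_complex_normal \<mu> 1 (h' c)"
  shows "\<forall>x\<in>F. is_arg_min p_out (\<lambda>z. z \<in> F) x \<longleftrightarrow> is_arg_max mean_sinr (\<lambda>z. z \<in> F) x"
proof -
  interpret prob_space \<mu> by fact
  \<comment> \<open>Index 1 represents all RIS elements, since their path losses do not depend on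
    \<open>n\<close>.\<close>
  define g where "g d = sqrt (\<beta> d (SR 1)) * sqrt (\<beta> d (RD 1))" for d
  define r where "r c \<omega> = cmod (h' c \<omega>)" for c \<omega>
  let ?E = "\<integral>\<omega>. (cmod (h_sc \<omega>))\<^sup>2 \<partial>\<mu>"
  \<comment> \<open>Since \<open>?E\<close> is positive, the interference constraint is an upper
    bound on the power; merging it with \<open>P_s_max\<close> makes \<open>F\<close> a product of
    two intervals.\<close>
  let ?P = "min P_s_max (I_th / ?E)"
  interpret ris_fading \<mu> r N M \<alpha> N\<^sub>0 P_b "sqrt (path_loss d\<^sub>0 \<eta> d_sd)" "sqrt (path_loss d\<^sub>0 \<eta> d_bd)"
  proof
    show "indep_vars (\<lambda>_. borel) r (channels N M)"
      unfolding r_def by (rule indep_vars_compose2[where Y="\<lambda>_. cmod"]) (use assms in auto)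
    show "0 < prob (r c -` {s<..<t} \<inter> space \<mu>)" if "c \<in> channels N M" "0 \<le> s" "s < t" for c s t
      unfolding r_def
      using circ_complex_normal_annulus_pos[of 1 "h' c" s t] assms that by simp
    show "integrable \<mu> (\<lambda>\<omega>. (r c \<omega>)\<^sup>2)" if "c \<in> channels N M" for c
      unfolding r_def
      using circ_complex_normal_integrable_square[of 1 "h' c"] assms that by simp
  qed (use assms in \<open>auto simp: r_def path_loss_def\<close>)
  have Gamma: "\<Gamma>_d (P, d) \<omega> = snr P (g d) (\<lambda>c. r c \<omega>)" for P d \<omega>
  proof -
    have "cmod (h d SD \<omega>) = sqrt (path_loss d\<^sub>0 \<eta> d_sd) * r SD \<omega>"
      and "cmod (h d (BD m) \<omega>) = sqrt (path_loss d\<^sub>0 \<eta> d_bd) * r (BD m) \<omega>"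
      and "cmod (h d (SR n) \<omega>) = sqrt (\<beta> d (SR 1)) * r (SR n) \<omega>"
      and "cmod (h d (RD n) \<omega>) = sqrt (\<beta> d (RD 1)) * r (RD n) \<omega>" for m n
      by (simp_all add: h_def \<beta>_def r_def norm_mult path_loss_def)
    then show ?thesis
      by (simp add: \<Gamma>_d_def sinr_def snr_def g_def sum_distrib_left mult_ac)
  qed
  have p_out: "p_out (P, d) = outage \<gamma>_th P (g d)" and mean: "mean_sinr (P, d) = mean_snr P (g d)" for P d
    by (simp_all add: p_out_def mean_sinr_def outage_def mean_snr_def Gamma cong: Bochner_Integration.integral_cong)
  have F: "(P, d) \<in> F \<longleftrightarrow> 0 \<le> P \<and> P \<le> ?P \<and>
      sqrt (\<delta>\<^sup>2 - y\<^sup>2) \<le> d \<and> d \<le> d_sd - sqrt (\<delta>\<^sup>2 - y\<^sup>2)" for P d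
    using \<open>?E > 0\<close> by (auto simp: F_def pos_le_divide_eq)
  have g: "0 \<le> g d" for d by (simp add: g_def \<beta>_def path_loss_def)
  have P: "0 < ?P" using assms by simp
  show ?thesis
  proof
    fix x assume "x \<in> F"
    obtain P d where x: "x = (P, d)" by (cases x)
    have Pd: "(P, d) \<in> F" using \<open>x \<in> F\<close> x by simp
    \<comment> \<open>A feasible move that worsens neither coordinate and strictly raises power or
      gain serves both objectives at once.\<close>
    have improve: "\<exists>z\<in>F. p_out z < p_out x \<and> mean_sinr x < mean_sinr z"
      if "(P', d') \<in> F" "P \<le> P'" "g d \<le> g d'" "0 < P'" "P < P' \<or> g d < g d'" for P' d'
      using that Pd g \<open>\<gamma>_th > 0\<close> unfolding x F
      by (intro bexI[of _ "(P', d')"])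
         (auto simp: p_out mean F intro!: outage_strict_antimono mean_snr_strict_mono)
    show "is_arg_min p_out (\<lambda>z. z \<in> F) x \<longleftrightarrow> is_arg_max mean_sinr (\<lambda>z. z \<in> F) x"
    proof (rule is_arg_min_iff_is_arg_max, cases "P < ?P")
      case True
      \<comment> \<open>The power can be raised to \<open>?P\<close> at the same location, because
        the constraints on power and location are separate.\<close>
      then show "(\<exists>z\<in>F. p_out z < p_out x \<and> mean_sinr x < mean_sinr z) \<or>
          (\<forall>z\<in>F. p_out x \<le> p_out z \<and> mean_sinr z \<le> mean_sinr x)"
        using improve[of ?P d] Pd P by (auto simp: F)
    next
      case False
      have "P \<le> ?P" using Pd by (simp only: F)
      with False have P_eq: "P = ?P" by (intro antisym) (simp_all only: not_less)
      show "(\<exists>z\<in>F. p_out z < p_out x \<and> mean_sinr x < mean_sinr z) \<or>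
          (\<forall>z\<in>F. p_out x \<le> p_out z \<and> mean_sinr z \<le> mean_sinr x)"
      \<comment> \<open>At full power only the location is left. The dichotomy asks just for some
        better gain, so no maximizer of \<open>g\<close> has to be exhibited.\<close>
      proof (cases "\<exists>P' d'. (P', d') \<in> F \<and> g d < g d'")
        case True
        then obtain P' d' where "(P', d') \<in> F" "g d < g d'" by auto
        then show ?thesis using improve[of P d'] Pd P P_eq by (auto simp: F)
      next
        case False
        \<comment> \<open>Now \<open>x\<close> has both the largest power and the largest gain, so
          weak monotonicity beats every competitor.\<close>
        have "p_out x \<le> p_out z \<and> mean_sinr z \<le> mean_sinr x" if "z \<in> F" for z
        proof -
          obtain P' d' where z: "z = (P', d')" by (cases z)
          then have "0 \<le> P'" "P' \<le> P" "g d' \<le> g d"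
            using that False P_eq by (auto simp: F not_less)
          then show ?thesis
            using g unfolding x z p_out mean by (intro conjI outage_antimono mean_snr_mono)
        qed
        then show ?thesis by blast
      qed
    qed
  qed
qed

end
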